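(* Let $R$ be a map and $L$ a linear block diffusion operator, let $P_j=I-\alpha_jhL+\beta_jh^2L^2$, let $U_j$ denote the stage solution of $$P_jU_j+\beta_jh^2LR(U_j)=r_j,$$ and define the fixed-point map $$\mathcal T_j(V)=P_j^{-1}\big(r_j-\beta_jh^2LR(V)\big).$$ If $R$ is Lipschitz with constant $L_R$ on a convex stage neighborhood and $$\kappa_j=\beta_jh^2\|P_j^{-1}L\|\,L_R<1,$$ then $\mathcal T_j$ is a contraction and the Picard iterates $V^{(m+1)}=\mathcal T_j(V^{(m)})$ converge geometrically. In particular, $$\|V^{(m)}-U_j\|\le\frac{\kappa_j^m}{1-\kappa_j}\,\|V^{(1)}-V^{(0)}\|.$$
   Context: The setting is the semilinear reaction--diffusion split $U_t=F(U)+G(U)$ with $F(U)=R(U)$ (explicit reaction) and $G(U)=LU$ (implicit diffusion), discretized by a compact two-stage two-derivative IMEX method with time step $h=\Delta t$. Since the temporal derivative of $G$ along the full field is $\dot G=L(R(U)+LU)$, either implicit stage $j\in\{1,2\}$ takes the form $P_jU_j+\beta_jh^2LR(U_j)=r_j$, where $r_j$ is the stage right-hand side and $(\alpha_1,\beta_1)=(\tfrac12,\tfrac18)$ (midpoint stage), $(\alpha_2,\beta_2)=(1,\tfrac16)$ (endpoint stage). $P_j^{-1}$ denotes the inverse of $P_j$.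
   Formalization: The stage solution U_j and all Picard iterates are assumed to lie in the convex stage neighborhood (otherwise iterates may leave it and the bound fails); L is read as a bounded operator on a real Banach space with P_j invertible. *)

theory Defs
  imports "HOL-Analysis.Analysis"
begin

definition stage_alpha :: "nat \<Rightarrow> real" where
  "stage_alpha j = (if j = 1 then 1/2 else 1)"

definition stage_beta :: "nat \<Rightarrow> real" where
  "stage_beta j = (if j = 1 then 1/8 else 1/6)"

text \<open>Stages are numbered \<open>j = 1\<close> (midpoint) and \<open>j = 2\<close> (endpoint); other values of \<open>j\<close> are
  not meaningful. The state space is an arbitrary real Banach space; after discretization in
  space it is finite-dimensional, and \<open>L\<close> is then just a linear map.\<close>

definition stage_op :: "real \<Rightarrow> ('a::real_normed_vector \<Rightarrow>\<^sub>L 'a) \<Rightarrow> nat \<Rightarrow> ('a \<Rightarrow>\<^sub>L 'a)" where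
  "stage_op h L j =
     id_blinfun - (stage_alpha j * h) *\<^sub>R L + (stage_beta j * h^2) *\<^sub>R (L o\<^sub>L L)"

definition blinfun_invertible :: "('a::real_normed_vector \<Rightarrow>\<^sub>L 'a) \<Rightarrow> bool" where
  "blinfun_invertible P \<longleftrightarrow> (\<exists>Q. Q o\<^sub>L P = id_blinfun \<and> P o\<^sub>L Q = id_blinfun)"

definition blinfun_inv :: "('a::real_normed_vector \<Rightarrow>\<^sub>L 'a) \<Rightarrow> ('a \<Rightarrow>\<^sub>L 'a)" where
  "blinfun_inv P = (THE Q. Q o\<^sub>L P = id_blinfun \<and> P o\<^sub>L Q = id_blinfun)"

lemma blinfun_inv:
  assumes "blinfun_invertible P"
  shows "blinfun_inv P o\<^sub>L P = id_blinfun" and "P o\<^sub>L blinfun_inv P = id_blinfun"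
proof -
  let ?I = "\<lambda>Q. Q o\<^sub>L P = id_blinfun \<and> P o\<^sub>L Q = id_blinfun"
  have unique: "Q = Q'" if "?I Q" and "?I Q'" for Q Q'
  proof (rule blinfun_eqI)
    fix x
    have "Q (P (Q' x)) = Q' x"
      using that(1) by (metis blinfun_apply_blinfun_compose id_blinfun.rep_eq id_apply)
    moreover have "P (Q' x) = x"
      using that(2) by (metis blinfun_apply_blinfun_compose id_blinfun.rep_eq id_apply)
    ultimately show "Q x = Q' x" by simp
  qed
  obtain Q where "?I Q"
    using assms unfolding blinfun_invertible_def by blast
  then have "?I (blinfun_inv P)"
    unfolding blinfun_inv_def by (rule theI) (rule unique[OF _ \<open>?I Q\<close>])
  then show "blinfun_inv P o\<^sub>L P = id_blinfun" and "P o\<^sub>L blinfun_inv P = id_blinfun"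
    by simp_all
qed

definition stage_solution ::
  "real \<Rightarrow> ('a::real_normed_vector \<Rightarrow>\<^sub>L 'a) \<Rightarrow> ('a \<Rightarrow> 'a) \<Rightarrow> nat \<Rightarrow> 'a \<Rightarrow> 'a \<Rightarrow> bool" where
  "stage_solution h L R j r U \<longleftrightarrow>
     stage_op h L j U + (stage_beta j * h^2) *\<^sub>R L (R U) = r"

definition picard_map ::
  "real \<Rightarrow> ('a::real_normed_vector \<Rightarrow>\<^sub>L 'a) \<Rightarrow> ('a \<Rightarrow> 'a) \<Rightarrow> nat \<Rightarrow> 'a \<Rightarrow> 'a \<Rightarrow> 'a" where
  "picard_map h L R j r V =
     blinfun_inv (stage_op h L j) (r - (stage_beta j * h^2) *\<^sub>R L (R V))"

definition stage_kappa ::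
  "real \<Rightarrow> ('a::real_normed_vector \<Rightarrow>\<^sub>L 'a) \<Rightarrow> nat \<Rightarrow> real \<Rightarrow> real" where
  "stage_kappa h L j L_R = stage_beta j * h^2 * norm (blinfun_inv (stage_op h L j) o\<^sub>L L) * L_R"

end

theory Submission
  imports Defs
begin

text \<open>Applying the inverse of the stage operator to the stage equation shows that the stage
  solution is a fixed point of the Picard map. This map is affine in \<open>R V\<close> with linear part
  \<open>-\<beta> h\<^sup>2 P\<^sup>-\<^sup>1 L\<close>, so its Lipschitz constant is \<open>\<kappa>\<close>. The
  geometric rate and the a priori bound are then those of any contraction.\<close>

text \<open>Since \<open>T\<close> fixes \<open>U\<close>, each step compares images of two points
  of \<open>N\<close> and so costs one factor \<open>k\<close>. Both other facts about the iteration
  rest on this bound.\<close>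

lemma lipschitz_iterates_dist_le:
  fixes T :: "'a::metric_space \<Rightarrow> 'a"
  assumes lip: "k-lipschitz_on N T" and U: "U \<in> N" "T U = U"
    and V: "\<And>m. V m \<in> N" "\<And>m. V (Suc m) = T (V m)"
  shows "dist (V m) U \<le> k ^ m * dist (V 0) U"
proof (induction m)
  case (Suc m)
  have "dist (V (Suc m)) U = dist (T (V m)) (T U)"
    by (simp only: U(2) V(2))
  also have "\<dots> \<le> k * dist (V m) U"
    using lipschitz_onD[OF lip V(1) U(1)] .
  also have "\<dots> \<le> k * (k ^ m * dist (V 0) U)"
    using Suc lipschitz_on_nonneg[OF lip] by (rule mult_left_mono)
  finally show ?case by (simp only: power_Suc mult.assoc)
qed simp

lemma contraction_iterates_tendsto:
  fixes T :: "'a::metric_space \<Rightarrow> 'a"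
  assumes lip: "k-lipschitz_on N T" and "k < 1" and "U \<in> N" "T U = U"
    and "\<And>m. V m \<in> N" "\<And>m. V (Suc m) = T (V m)"
  shows "V \<longlonglongrightarrow> U"
proof -
  note geom = lipschitz_iterates_dist_le[where V = V, OF lip assms(3-)]
  \<comment> \<open>A Lipschitz constant is nonnegative by definition, so \<open>k < 1\<close>
    already confines \<open>k\<close> to the range where its powers vanish.\<close>
  have "(\<lambda>m. k ^ m) \<longlonglongrightarrow> 0"
    using lipschitz_on_nonneg[OF lip] \<open>k < 1\<close> by (rule LIMSEQ_realpow_zero)
  then have lim: "(\<lambda>m. k ^ m * dist (V 0) U) \<longlonglongrightarrow> 0"
    by (rule tendsto_mult_left_zero)
  have "(\<lambda>m. dist (V m) U) \<longlonglongrightarrow> 0"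
    by (rule tendsto_sandwich[OF _ _ tendsto_const lim]) (simp_all only: zero_le_dist geom eventually_True)
  then show ?thesis
    by (simp only: tendsto_dist_iff[of V U])
qed

text \<open>The unknown initial error is traded for the computable first increment. As the fixed
  point is given, one triangle inequality replaces the usual summation of a geometric
  series.\<close>

lemma contraction_iterates_apriori:
  fixes T :: "'a::metric_space \<Rightarrow> 'a"
  assumes lip: "k-lipschitz_on N T" and "k < 1" and "U \<in> N" "T U = U"
    and "\<And>m. V m \<in> N" "\<And>m. V (Suc m) = T (V m)"
  shows "dist (V m) U \<le> k ^ m / (1 - k) * dist (V 1) (V 0)"
proof -
  note geom = lipschitz_iterates_dist_le[where V = V, OF lip assms(3-)]
  have "dist (V 0) U \<le> dist (V 1) (V 0) + dist (V 1) U"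
    by (rule dist_triangle3)
  also have "dist (V 1) U \<le> k * dist (V 0) U"
    using geom[of 1] by simp
  \<comment> \<open>The term \<open>k * dist (V 0) U\<close> is absorbed on the left, and division
    by \<open>1 - k > 0\<close> isolates the initial error.\<close>
  finally have "dist (V 0) U \<le> dist (V 1) (V 0) / (1 - k)"
    using \<open>k < 1\<close> by (simp add: field_simps)
  then have "k ^ m * dist (V 0) U \<le> k ^ m * (dist (V 1) (V 0) / (1 - k))"
    using lipschitz_on_nonneg[OF lip] by (intro mult_left_mono) auto
  with geom[of m] show ?thesis by simp
qed

lemma stage_beta_nonneg: "0 \<le> stage_beta j"
  by (simp add: stage_beta_def)

lemma picard_map_stage_solution:
  assumes "blinfun_invertible (stage_op h L j)" and "stage_solution h L R j r U"
  shows "picard_map h L R j r U = U"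
proof -
  have "picard_map h L R j r U = blinfun_inv (stage_op h L j) (stage_op h L j U)"
    using assms(2) by (auto simp: picard_map_def stage_solution_def)
  also have "\<dots> = U"
    using blinfun_inv(1)[OF assms(1)]
    by (metis blinfun_apply_blinfun_compose id_blinfun.rep_eq id_apply)
  finally show ?thesis .
qed

lemma picard_map_lipschitz_on:
  assumes lip: "L_R-lipschitz_on N R"
  shows "(stage_kappa h L j L_R)-lipschitz_on N (picard_map h L R j r)"
proof (rule lipschitz_onI)
  let ?PL = "blinfun_inv (stage_op h L j) o\<^sub>L L"
  let ?b = "stage_beta j * h^2"
  have b: "0 \<le> ?b"
    by (simp add: stage_beta_nonneg)
  show "0 \<le> stage_kappa h L j L_R"
    using b lipschitz_on_nonneg[OF lip] by (simp add: stage_kappa_def)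
  fix x y assume "x \<in> N" "y \<in> N"
  \<comment> \<open>The constant \<open>r\<close> cancels, and the minus sign in front of the
    reaction term swaps \<open>R x\<close> and \<open>R y\<close>.\<close>
  have "picard_map h L R j r x - picard_map h L R j r y = ?b *\<^sub>R ?PL (R y - R x)"
    by (simp add: picard_map_def blinfun.diff_right blinfun.scaleR_right scaleR_diff_right)
  then have "dist (picard_map h L R j r x) (picard_map h L R j r y) = norm (?b *\<^sub>R ?PL (R y - R x))"
    by (simp only: dist_norm)
  also have "\<dots> = ?b * norm (?PL (R y - R x))"
    using b by simp
  \<comment> \<open>The inverse and \<open>L\<close> are estimated as one operator, because \<kappa>
    contains the norm of their composition and not the product of their norms.\<close>
  also have "\<dots> \<le> ?b * (norm ?PL * norm (R y - R x))"
    using norm_blinfun b by (rule mult_left_mono)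
  also have "\<dots> \<le> ?b * (norm ?PL * (L_R * dist x y))"
    using b lipschitz_onD[OF lip \<open>y \<in> N\<close> \<open>x \<in> N\<close>]
    by (intro mult_left_mono) (simp_all add: dist_norm norm_minus_commute)
  finally show "dist (picard_map h L R j r x) (picard_map h L R j r y)
      \<le> stage_kappa h L j L_R * dist x y"
    by (simp add: stage_kappa_def mult.assoc)
qed

theorem proposition7p3:
  fixes R :: "'a::banach \<Rightarrow> 'a" and L :: "'a \<Rightarrow>\<^sub>L 'a" and r :: 'a and N :: "'a set"
    and h L_R :: real and j :: nat
  assumes "j \<in> {1, 2}"
    and "h > 0"
    and "blinfun_invertible (stage_op h L j)"
    and "convex N"
    and "L_R-lipschitz_on N R"
    and "stage_kappa h L j L_R < 1"
  shows "(stage_kappa h L j L_R)-lipschitz_on N (picard_map h L R j r) \<and>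
    (\<forall>U V. U \<in> N \<and> stage_solution h L R j r U \<and>
        (\<forall>m. V m \<in> N) \<and> (\<forall>m. V (Suc m) = picard_map h L R j r (V m)) \<longrightarrow>
      V \<longlonglongrightarrow> U \<and>
      (\<forall>m. norm (V m - U) \<le> stage_kappa h L j L_R ^ m * norm (V 0 - U)) \<and>
      (\<forall>m. norm (V m - U) \<le>
        stage_kappa h L j L_R ^ m / (1 - stage_kappa h L j L_R) * norm (V 1 - V 0)))"
proof (intro conjI allI impI; (elim conjE)?)
  show lip: "(stage_kappa h L j L_R)-lipschitz_on N (picard_map h L R j r)"
    by (rule picard_map_lipschitz_on) fact
  fix U V
  assume U: "U \<in> N" and sol: "stage_solution h L R j r U" and V: "\<forall>m. V m \<in> N"
    and step: "\<forall>m. V (Suc m) = picard_map h L R j r (V m)"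
  have fix_U: "picard_map h L R j r U = U"
    using assms(3) sol by (rule picard_map_stage_solution)
  \<comment> \<open>The Lipschitz bound holds on \<open>N\<close> only; it applies along the whole
    iteration because \<open>U\<close> and every iterate are assumed to lie there.\<close>
  note iter = U fix_U V[rule_format] step[rule_format]
  show "V \<longlonglongrightarrow> U"
    using contraction_iterates_tendsto[where V = V, OF lip assms(6) iter] .
  fix m
  show "norm (V m - U) \<le> stage_kappa h L j L_R ^ m * norm (V 0 - U)"
    using lipschitz_iterates_dist_le[where V = V, OF lip iter] by (simp add: dist_norm)
  show "norm (V m - U) \<le>
      stage_kappa h L j L_R ^ m / (1 - stage_kappa h L j L_R) * norm (V 1 - V 0)"
    using contraction_iterates_apriori[where V = V, OF lip assms(6) iter] by (simp add: dist_norm)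
qed

end
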